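(* Let $n\in\mathbb{N}$ be given. There are infinitely many everywhere defined non-closable unbounded operators $T$ such that $T^n=I$ everywhere on some Hilbert space while $T^p\neq I$ for $p=1,2,\ldots,n-1$.
   Context: Hilbert spaces are complex, operators are linear, and $I$ denotes the identity operator on the Hilbert space where $T$ acts. An operator $T$ on a Hilbert space $K$ with domain $D(T)\subset K$ is everywhere defined if $D(T)=K$. It is closable if, for every sequence $(x_k)$ in $D(T)$ with $x_k\to 0$ and $Tx_k\to y$, one has $y=0$; otherwise it is non-closable.
   Formalization: The case n = 1 is excluded, because there T^1 = I forces T = I, which is bounded and closable, so the claim fails for n = 1; all other n are covered. *)

theory Defs
  imports Complex_Main "HOL-Library.Function_Algebras"
begin

definition ip_norm :: "('a \<Rightarrow> 'a \<Rightarrow> complex) \<Rightarrow> 'a \<Rightarrow> real" where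
  "ip_norm ip x = sqrt (Re (ip x x))"

definition ip_tendsto ::
  "('a::ab_group_add \<Rightarrow> 'a \<Rightarrow> complex) \<Rightarrow> (nat \<Rightarrow> 'a) \<Rightarrow> 'a \<Rightarrow> bool" where
  "ip_tendsto ip X l \<longleftrightarrow> (\<lambda>k. ip_norm ip (X k - l)) \<longlonglongrightarrow> 0"

definition ip_Cauchy ::
  "('a::ab_group_add \<Rightarrow> 'a \<Rightarrow> complex) \<Rightarrow> (nat \<Rightarrow> 'a) \<Rightarrow> bool" where
  "ip_Cauchy ip X \<longleftrightarrow>
     (\<forall>e>0. \<exists>N. \<forall>j\<ge>N. \<forall>k\<ge>N. ip_norm ip (X j - X k) < e)"

text \<open>A complex Hilbert space is given by a carrier H, a linear subspace of some ambient complex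
  vector space supplying the algebraic operations, together with an inner product on H. The ambient
  space carries no topology, and the values of the inner product outside H are irrelevant.\<close>

locale complex_hilbert_space = vector_space scale
  for scale :: "complex \<Rightarrow> 'a::ab_group_add \<Rightarrow> 'a" +
  fixes H :: "'a set"
    and ip :: "'a \<Rightarrow> 'a \<Rightarrow> complex"
  assumes subspace_carrier: "subspace H"
    and ip_add_left: "\<lbrakk>x \<in> H; y \<in> H; z \<in> H\<rbrakk> \<Longrightarrow> ip (x + y) z = ip x z + ip y z"
    and ip_scale_left: "\<lbrakk>x \<in> H; y \<in> H\<rbrakk> \<Longrightarrow> ip (scale c x) y = c * ip x y"
    and ip_commute: "\<lbrakk>x \<in> H; y \<in> H\<rbrakk> \<Longrightarrow> ip x y = cnj (ip y x)"
    and ip_nonneg: "x \<in> H \<Longrightarrow> 0 \<le> Re (ip x x)"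
    and ip_definite: "\<lbrakk>x \<in> H; ip x x = 0\<rbrakk> \<Longrightarrow> x = 0"
    and ip_complete:
      "\<lbrakk>\<And>k. X k \<in> H; ip_Cauchy ip X\<rbrakk> \<Longrightarrow> \<exists>l\<in>H. ip_tendsto ip X l"

text \<open>Operators are partial maps, so that D(T) is \<^term>\<open>dom T\<close> and two operators are equal
  exactly when they have the same domain and the same values on it.\<close>

definition linear_operator ::
  "(complex \<Rightarrow> 'a::ab_group_add \<Rightarrow> 'a) \<Rightarrow> 'a set \<Rightarrow> ('a \<rightharpoonup> 'a) \<Rightarrow> bool" where
  "linear_operator scale H T \<longleftrightarrow>
     dom T \<subseteq> H \<and> ran T \<subseteq> H \<and> module.subspace scale (dom T) \<and>
     (\<forall>x\<in>dom T. \<forall>y\<in>dom T. the (T (x + y)) = the (T x) + the (T y)) \<and>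
     (\<forall>c. \<forall>x\<in>dom T. the (T (scale c x)) = scale c (the (T x)))"

definition everywhere_defined :: "'a set \<Rightarrow> ('a \<rightharpoonup> 'a) \<Rightarrow> bool" where
  "everywhere_defined H T \<longleftrightarrow> dom T = H"

definition bounded_operator :: "('a \<Rightarrow> 'a \<Rightarrow> complex) \<Rightarrow> ('a \<rightharpoonup> 'a) \<Rightarrow> bool" where
  "bounded_operator ip T \<longleftrightarrow>
     (\<exists>M. \<forall>x\<in>dom T. ip_norm ip (the (T x)) \<le> M * ip_norm ip x)"

definition closable ::
  "'a set \<Rightarrow> ('a::ab_group_add \<Rightarrow> 'a \<Rightarrow> complex) \<Rightarrow> ('a \<rightharpoonup> 'a) \<Rightarrow> bool" where
  "closable H ip T \<longleftrightarrow>
     (\<forall>X. \<forall>y\<in>H. (\<forall>k. X k \<in> dom T) \<longrightarrow> ip_tendsto ip X 0 \<longrightarrow>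
        ip_tendsto ip (\<lambda>k. the (T (X k))) y \<longrightarrow> y = 0)"

definition identity_operator :: "'a set \<Rightarrow> ('a \<rightharpoonup> 'a)" where
  "identity_operator H = Some |` H"

text \<open>Since \<^term>\<open>(\<circ>\<^sub>m)\<close> composes partial maps, powers have their natural domain.\<close>

primrec operator_power :: "'a set \<Rightarrow> ('a \<rightharpoonup> 'a) \<Rightarrow> nat \<Rightarrow> ('a \<rightharpoonup> 'a)" where
  "operator_power H T 0 = identity_operator H"
| "operator_power H T (Suc n) = T \<circ>\<^sub>m operator_power H T n"

end

theory Submission
  imports Defs
begin

text \<open>On a Hilbert space \<open>H\<close> choose a vector \<open>e\<close> and a discontinuous linear functional \<open>f\<close> with
  \<open>f e = 1\<close>. Then \<open>H\<close> is the direct sum of \<open>ker f\<close> and the line through \<open>e\<close>, and the operator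
  \<open>T x = x + (w - 1) f(x) e\<close> is the identity on the first summand and multiplication by \<open>w\<close> on the
  second. Its powers are obtained by replacing \<open>w\<close> with its powers, so a primitive \<open>n\<close>-th root of
  unity \<open>w\<close> gives \<open>T\<^sup>n = I\<close> and no earlier power equal to \<open>I\<close>. As \<open>f\<close> is discontinuous, there are
  vectors \<open>x\<^sub>k\<close> tending to \<open>0\<close> with \<open>f x\<^sub>k = 1\<close>, and \<open>T x\<^sub>k = x\<^sub>k + (w - 1) e\<close> tends to the nonzero
  vector \<open>(w - 1) e\<close>; hence \<open>T\<close> is not closable, and a fortiori unbounded.

  The space is the sequence space \<open>\<ell>\<^sup>2\<close>. The unit sequences \<open>\<delta>\<^sub>k\<close> are linearly independent, so a
  Hamel basis argument provides a functional with \<open>f \<delta>\<^sub>k = k\<close>; it is discontinuous because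
  \<open>\<delta>\<^sub>k / k\<close> tends to \<open>0\<close>. Since \<open>f \<delta>\<^sub>1 = 1\<close> and \<open>f \<delta>\<^sub>0 = 0\<close>, every vector \<open>e = \<delta>\<^sub>1 + t \<delta>\<^sub>0\<close>
  satisfies \<open>f e = 1\<close>, and different values of \<open>t\<close> give different operators.

  For \<open>n = 0\<close> the condition on powers is void and any \<open>w \<noteq> 1\<close> will do. The value \<open>n = 1\<close> is
  excluded since it forces \<open>T = I\<close>, which is bounded.\<close>

section \<open>Dilations along a line\<close>

definition axis_dilation ::
  "(complex \<Rightarrow> 'a::ab_group_add \<Rightarrow> 'a) \<Rightarrow> 'a set \<Rightarrow> ('a \<Rightarrow> complex) \<Rightarrow> 'a \<Rightarrow> complex \<Rightarrow> ('a \<rightharpoonup> 'a)" where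
  "axis_dilation scale H f e w = (\<lambda>x. if x \<in> H then Some (x + scale ((w - 1) * f x) e) else None)"

lemma dom_axis_dilation [simp]: "dom (axis_dilation scale H f e w) = H"
  by (auto simp: axis_dilation_def dom_def)

lemma axis_dilation_apply: "x \<in> H \<Longrightarrow> axis_dilation scale H f e w x = Some (x + scale ((w - 1) * f x) e)"
  by (simp add: axis_dilation_def)

text \<open>These two rules replace an interpretation of the locale of linear maps: for scalar multiplication
  \<open>(*)\<close> on \<open>\<complex>\<close>, its simp rule \<open>a * (b * x) = (a * b) * x\<close> loops with \<open>algebra_simps\<close>.\<close>

lemma linear_functional_simps:
  assumes "Vector_Spaces.linear scale (*) f"
  shows "f (x + y) = f x + f y" "f (scale c x) = c * f x"
  using Vector_Spaces.linear.axioms(3)[OF assms] by (simp_all add: module_hom.add module_hom.scale)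

context complex_hilbert_space
begin

lemma axis_dilation_in_carrier:
  assumes "x \<in> H" "e \<in> H"
  shows "x + scale c e \<in> H"
  using assms subspace_carrier by (intro subspace_add subspace_scale)

lemma linear_operator_axis_dilation:
  assumes f: "Vector_Spaces.linear scale (*) f" and e: "e \<in> H"
  shows "linear_operator scale H (axis_dilation scale H f e w)"
proof -
  have "ran (axis_dilation scale H f e w) \<subseteq> H"
    using axis_dilation_in_carrier[OF _ e]
    by (auto simp: ran_def axis_dilation_def split: if_splits)
  moreover have "(x + y) + scale ((w - 1) * f (x + y)) e
      = (x + scale ((w - 1) * f x) e) + (y + scale ((w - 1) * f y) e)" for x y
    by (simp only: linear_functional_simps[OF f] distrib_left scale_left_distrib ac_simps)
  moreover have "scale c x + scale ((w - 1) * f (scale c x)) e = scale c (x + scale ((w - 1) * f x) e)"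
    for c x
    by (simp only: linear_functional_simps[OF f] scale_right_distrib scale_scale mult.left_commute)
  ultimately show ?thesis
    using subspace_carrier
    by (simp add: linear_operator_def axis_dilation_apply subspace_add subspace_scale)
qed

lemma axis_dilation_one: "axis_dilation scale H f e 1 = identity_operator H"
  by (auto simp: axis_dilation_def identity_operator_def restrict_map_def)

text \<open>Because \<open>f e = 1\<close>, applying the dilation with factor \<open>w\<close> multiplies the value of \<open>f\<close> by \<open>w\<close>.
  The factors of successive dilations therefore multiply.\<close>

lemma axis_dilation_compose:
  assumes f: "Vector_Spaces.linear scale (*) f" and e: "e \<in> H" "f e = 1"
  shows "axis_dilation scale H f e v \<circ>\<^sub>m axis_dilation scale H f e w = axis_dilation scale H f e (v * w)"
proof
  fix x
  show "(axis_dilation scale H f e v \<circ>\<^sub>m axis_dilation scale H f e w) x = axis_dilation scale H f e (v * w) x"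
  proof (cases "x \<in> H")
    case True
    let ?y = "x + scale ((w - 1) * f x) e"
    have "f ?y = w * f x"
      by (simp only: linear_functional_simps[OF f] e) (simp add: algebra_simps)
    then have "?y + scale ((v - 1) * f ?y) e = x + scale ((w - 1) * f x + (v - 1) * (w * f x)) e"
      by (simp add: scale_left_distrib add.assoc)
    also have "(w - 1) * f x + (v - 1) * (w * f x) = (v * w - 1) * f x"
      by (simp add: algebra_simps)
    finally show ?thesis
      using True axis_dilation_in_carrier[OF True e(1)]
      by (simp add: map_comp_def axis_dilation_apply)
  qed (simp add: map_comp_def axis_dilation_def)
qed

lemma operator_power_axis_dilation:
  assumes "Vector_Spaces.linear scale (*) f" "e \<in> H" "f e = 1"
  shows "operator_power H (axis_dilation scale H f e w) k = axis_dilation scale H f e (w ^ k)"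
  by (induction k) (simp_all add: axis_dilation_one axis_dilation_compose[OF assms])

lemma axis_dilation_inject:
  assumes "e \<in> H" "f e = 1" "e \<noteq> 0"
    and "axis_dilation scale H f e v = axis_dilation scale H f e w"
  shows "v = w"
proof -
  from assms(4) have "axis_dilation scale H f e v e = axis_dilation scale H f e w e"
    by simp
  then show ?thesis
    using assms(1-3) by (simp add: axis_dilation_apply)
qed

section \<open>Closability and boundedness\<close>

lemma ip_norm_eq_0_imp:
  assumes "x \<in> H" "ip_norm ip x = 0"
  shows "x = 0"
proof -
  have "Im (ip x x) = Im (cnj (ip x x))"
    using ip_commute[OF assms(1) assms(1)] by simp
  with assms show ?thesis
    by (intro ip_definite) (auto simp: ip_norm_def complex_eq_iff)
qed

lemma ip_norm_scale:
  assumes "x \<in> H"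
  shows "ip_norm ip (scale c x) = cmod c * ip_norm ip x"
proof -
  have cx: "scale c x \<in> H" using assms subspace_carrier by (rule subspace_scale[rotated])
  have "ip (scale c x) (scale c x) = c * cnj (c * ip x x)"
    using ip_scale_left[OF assms cx] ip_commute[OF assms cx] ip_scale_left[OF assms assms] by simp
  also have "\<dots> = c * cnj c * ip x x"
    using ip_commute[OF assms assms] by simp
  also have "\<dots> = complex_of_real ((cmod c)\<^sup>2) * ip x x"
    by (simp only: complex_norm_square)
  finally show ?thesis
    by (simp add: ip_norm_def real_sqrt_mult)
qed

text \<open>One half of the parallelogram law; it stands in for the triangle inequality, which would
  require the Cauchy-Schwarz inequality.\<close>

lemma ip_norm_add_square_le:
  assumes x: "x \<in> H" and y: "y \<in> H"
  shows "(ip_norm ip (x + y))\<^sup>2 \<le> 2 * (ip_norm ip x)\<^sup>2 + 2 * (ip_norm ip y)\<^sup>2"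
proof -
  define z where "z = scale (-1) y"
  have z: "z \<in> H"
    unfolding z_def by (rule subspace_scale[OF subspace_carrier y])
  have xy: "x + y \<in> H" and xz: "x + z \<in> H"
    using x y z subspace_carrier by (auto intro: subspace_add)
  have add_right: "ip a (b + c) = ip a b + ip a c" if "a \<in> H" "b \<in> H" "c \<in> H" for a b c
  proof -
    have "b + c \<in> H" using that subspace_carrier by (simp add: subspace_add)
    then show ?thesis
      using ip_add_left[OF that(2,3,1)] ip_commute that by (metis complex_cnj_add)
  qed
  have zl: "ip z a = - ip y a" if "a \<in> H" for a
    using ip_scale_left[OF y that, of "-1"] by (simp add: z_def)
  have zr: "ip x z = - ip x y" "ip y z = - ip y y"
    using zl x y z ip_commute by (metis complex_cnj_minus)+
  have "0 \<le> Re (ip (x + z) (x + z))" by (rule ip_nonneg[OF xz])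
  also have "ip (x + z) (x + z) = ip x x - ip x y - ip y x + ip y y"
    using x y z xz zl zr by (simp add: ip_add_left add_right)
  finally have "Re (ip x y) + Re (ip y x) \<le> Re (ip x x) + Re (ip y y)" by simp
  moreover have "ip (x + y) (x + y) = ip x x + ip x y + ip y x + ip y y"
    using x y xy by (simp add: ip_add_left add_right)
  moreover have "(ip_norm ip a)\<^sup>2 = Re (ip a a)" if "a \<in> H" for a
    using ip_nonneg[OF that] by (simp add: ip_norm_def)
  ultimately show ?thesis
    using x y xy by simp
qed

lemma bounded_operator_imp_closable:
  assumes ran: "ran T \<subseteq> H" and dom: "dom T \<subseteq> H" and bdd: "bounded_operator ip T"
  shows "closable H ip T"
  unfolding closable_def
proof (intro allI ballI impI)
  fix X y
  assume y: "y \<in> H" and X: "\<forall>k. X k \<in> dom T" and X0: "ip_tendsto ip X 0"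
    and Ty: "ip_tendsto ip (\<lambda>k. the (T (X k))) y"
  obtain M where M: "ip_norm ip (the (T x)) \<le> M * ip_norm ip x" if "x \<in> dom T" for x
    using bdd by (auto simp: bounded_operator_def)
  have TX: "the (T (X k)) \<in> H" for k
    using X[rule_format, of k] ran by (auto simp: ran_def)
  have nonneg: "0 \<le> ip_norm ip (the (T (X k)))" for k
    using ip_nonneg[OF TX] by (simp add: ip_norm_def)
  have "(\<lambda>k. M * ip_norm ip (X k)) \<longlonglongrightarrow> M * 0"
    using X0 by (intro tendsto_mult_left) (simp add: ip_tendsto_def)
  then have lim: "(\<lambda>k. M * ip_norm ip (X k)) \<longlonglongrightarrow> 0" by simp
  have "(\<lambda>k. ip_norm ip (the (T (X k)))) \<longlonglongrightarrow> 0"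
  proof (rule tendsto_sandwich[OF _ _ tendsto_const lim])
    show "\<forall>\<^sub>F k in sequentially. 0 \<le> ip_norm ip (the (T (X k)))"
      by (simp add: nonneg)
    show "\<forall>\<^sub>F k in sequentially. ip_norm ip (the (T (X k))) \<le> M * ip_norm ip (X k)"
      using M X by simp
  qed
  moreover have "(ip_norm ip y)\<^sup>2 \<le> 2 * (ip_norm ip (the (T (X k)) - y))\<^sup>2 + 2 * (ip_norm ip (the (T (X k))))\<^sup>2"
    for k
  proof -
    let ?a = "the (T (X k))"
    have d: "?a - y \<in> H" using TX y subspace_carrier by (simp add: subspace_diff)
    have "ip_norm ip (scale (-1) (?a - y)) = ip_norm ip (?a - y)"
      using ip_norm_scale[OF d, of "-1"] by simp
    then have "ip_norm ip (y - ?a) = ip_norm ip (?a - y)" by simp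
    moreover have "y - ?a \<in> H" using TX y subspace_carrier by (simp add: subspace_diff)
    ultimately show ?thesis
      using ip_norm_add_square_le[OF \<open>y - ?a \<in> H\<close> TX[of k]] by simp
  qed
  moreover have "(\<lambda>k. ip_norm ip (the (T (X k)) - y)) \<longlonglongrightarrow> 0"
    using Ty by (simp add: ip_tendsto_def)
  ultimately have "(ip_norm ip y)\<^sup>2 \<le> 2 * 0\<^sup>2 + 2 * 0\<^sup>2"
    by (intro LIMSEQ_le_const[of "\<lambda>k. 2 * (ip_norm ip (the (T (X k)) - y))\<^sup>2 + 2 * (ip_norm ip (the (T (X k))))\<^sup>2"]
          tendsto_intros) auto
  then show "y = 0"
    using ip_norm_eq_0_imp[OF y] by simp
qed

text \<open>Along \<open>X\<close> the operator only adds the fixed vector \<open>(w - 1) e\<close>, which is thus the limit of the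
  images of a null sequence.\<close>

lemma not_closable_axis_dilation:
  assumes e: "e \<in> H" "e \<noteq> 0" and w: "w \<noteq> 1"
    and X: "\<And>k. X k \<in> H" "\<And>k. f (X k) = 1" "ip_tendsto ip X 0"
  shows "\<not> closable H ip (axis_dilation scale H f e w)"
proof
  assume "closable H ip (axis_dilation scale H f e w)"
  moreover have "scale (w - 1) e \<in> H"
    using e subspace_carrier by (simp add: subspace_scale)
  moreover have "ip_tendsto ip (\<lambda>k. the (axis_dilation scale H f e w (X k))) (scale (w - 1) e)"
    using X by (simp add: ip_tendsto_def axis_dilation_apply)
  ultimately have "scale (w - 1) e = 0"
    using X unfolding closable_def dom_axis_dilation by blast
  with e w show False by simp
qed

end

section \<open>The Hilbert space of square-summable sequences\<close>

definition seq_scale :: "complex \<Rightarrow> (nat \<Rightarrow> complex) \<Rightarrow> (nat \<Rightarrow> complex)" where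
  "seq_scale c x = (\<lambda>i. c * x i)"

definition ell2 :: "(nat \<Rightarrow> complex) set" where
  "ell2 = {x. summable (\<lambda>i. (cmod (x i))\<^sup>2)}"

definition ell2_ip :: "(nat \<Rightarrow> complex) \<Rightarrow> (nat \<Rightarrow> complex) \<Rightarrow> complex" where
  "ell2_ip x y = (\<Sum>i. x i * cnj (y i))"

definition unit_seq :: "nat \<Rightarrow> nat \<Rightarrow> complex" where
  "unit_seq k = (\<lambda>i. if i = k then 1 else 0)"

lemma vector_space_seq_scale: "vector_space seq_scale"
  by unfold_locales (auto simp: seq_scale_def fun_eq_iff algebra_simps)

interpretation seqs: vector_space seq_scale
  by (rule vector_space_seq_scale)

lemma subspace_ell2: "seqs.subspace ell2"
  unfolding seqs.subspace_def
proof (intro conjI ballI allI)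
  fix x y :: "nat \<Rightarrow> complex"
  assume xy: "x \<in> ell2" "y \<in> ell2"
  have le: "(cmod (a + b))\<^sup>2 \<le> 2 * (cmod a)\<^sup>2 + 2 * (cmod b)\<^sup>2" for a b :: complex
  proof -
    have "(cmod (a + b))\<^sup>2 \<le> (cmod a + cmod b)\<^sup>2"
      by (intro power_mono norm_triangle_ineq) simp
    also have "\<dots> \<le> 2 * (cmod a)\<^sup>2 + 2 * (cmod b)\<^sup>2"
      using zero_le_power2[of "cmod a - cmod b"] by (simp add: power2_sum power2_diff)
    finally show ?thesis .
  qed
  have "summable (\<lambda>i. 2 * (cmod (x i))\<^sup>2 + 2 * (cmod (y i))\<^sup>2)"
    using xy by (intro summable_add summable_mult) (auto simp: ell2_def)
  then show "x + y \<in> ell2"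
    unfolding ell2_def mem_Collect_eq
    by (rule summable_comparison_test'[where N = 0]) (simp add: le)
next
  fix c and x :: "nat \<Rightarrow> complex"
  assume "x \<in> ell2"
  then show "seq_scale c x \<in> ell2"
    by (simp add: ell2_def seq_scale_def norm_mult power_mult_distrib summable_mult)
qed (simp add: ell2_def)

lemma ell2_ip_summable:
  assumes "x \<in> ell2" "y \<in> ell2"
  shows "summable (\<lambda>i. x i * cnj (y i))"
proof (rule summable_comparison_test')
  show "summable (\<lambda>i. (cmod (x i))\<^sup>2 + (cmod (y i))\<^sup>2)"
    using assms by (intro summable_add) (auto simp: ell2_def)
  show "norm (x i * cnj (y i)) \<le> (cmod (x i))\<^sup>2 + (cmod (y i))\<^sup>2" if "i \<ge> 0" for i
  proof -
    have "0 \<le> cmod (x i) * cmod (y i)" by simp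
    moreover have "2 * (cmod (x i) * cmod (y i)) \<le> (cmod (x i))\<^sup>2 + (cmod (y i))\<^sup>2"
      using zero_le_power2[of "cmod (x i) - cmod (y i)"] by (simp add: power2_diff)
    ultimately show ?thesis unfolding norm_mult complex_mod_cnj by linarith
  qed
qed

lemma ell2_ip_self:
  assumes "x \<in> ell2"
  shows "ell2_ip x x = complex_of_real (\<Sum>i. (cmod (x i))\<^sup>2)"
proof -
  have "ell2_ip x x = (\<Sum>i. complex_of_real ((cmod (x i))\<^sup>2))"
    unfolding ell2_ip_def by (simp only: complex_norm_square)
  also have "\<dots> = complex_of_real (\<Sum>i. (cmod (x i))\<^sup>2)"
    using assms by (intro suminf_of_real[symmetric]) (simp add: ell2_def)
  finally show ?thesis .
qed

lemma ell2_norm_square: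
  assumes "x \<in> ell2"
  shows "(ip_norm ell2_ip x)\<^sup>2 = (\<Sum>i. (cmod (x i))\<^sup>2)"
  using assms suminf_nonneg[of "\<lambda>i. (cmod (x i))\<^sup>2"]
  by (simp add: ip_norm_def ell2_ip_self ell2_def)

lemma ell2_norm_nonneg: "x \<in> ell2 \<Longrightarrow> 0 \<le> ip_norm ell2_ip x"
  using suminf_nonneg[of "\<lambda>i. (cmod (x i))\<^sup>2"]
  by (simp add: ip_norm_def ell2_ip_self ell2_def)

lemma sum_le_ell2_norm_square:
  assumes "x \<in> ell2"
  shows "(\<Sum>i<m. (cmod (x i))\<^sup>2) \<le> (ip_norm ell2_ip x)\<^sup>2"
  unfolding ell2_norm_square[OF assms]
  using assms by (intro sum_le_suminf) (auto simp: ell2_def)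

lemma coordinate_le_ell2_norm:
  assumes "x \<in> ell2"
  shows "cmod (x i) \<le> ip_norm ell2_ip x"
proof (rule power2_le_imp_le)
  have "(cmod (x i))\<^sup>2 \<le> (\<Sum>j<Suc i. (cmod (x j))\<^sup>2)"
    by (simp add: sum_nonneg)
  also have "\<dots> \<le> (ip_norm ell2_ip x)\<^sup>2"
    by (rule sum_le_ell2_norm_square[OF assms])
  finally show "(cmod (x i))\<^sup>2 \<le> (ip_norm ell2_ip x)\<^sup>2" .
qed (rule ell2_norm_nonneg[OF assms])

lemma ell2_norm_leI:
  assumes "\<And>m. (\<Sum>i<m. (cmod (x i))\<^sup>2) \<le> r\<^sup>2" "0 \<le> r"
  shows "x \<in> ell2" "ip_norm ell2_ip x \<le> r"
proof -
  show x: "x \<in> ell2"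
    unfolding ell2_def mem_Collect_eq using assms(1) by (intro summableI_nonneg_bounded) auto
  have "(ip_norm ell2_ip x)\<^sup>2 \<le> r\<^sup>2"
    unfolding ell2_norm_square[OF x]
    using assms(1) x by (intro suminf_le_const) (auto simp: ell2_def)
  then show "ip_norm ell2_ip x \<le> r"
    using assms(2) by (rule power2_le_imp_le)
qed

text \<open>A Cauchy sequence converges in each coordinate. The bounds on the finite partial sums of
  \<open>X j - X k\<close> survive the limit \<open>k \<rightarrow> \<infinity>\<close>, and this gives both membership of the coordinatewise limit
  in the space and convergence in norm.\<close>

lemma ell2_complete:
  assumes X: "\<And>k. X k \<in> ell2" and C: "ip_Cauchy ell2_ip X"
  shows "\<exists>l\<in>ell2. ip_tendsto ell2_ip X l"
proof -
  have diff: "X j - X k \<in> ell2" for j k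
    using X subspace_ell2 by (simp add: seqs.subspace_diff)
  have "Cauchy (\<lambda>k. X k i)" for i
  proof (rule metric_CauchyI)
    fix r :: real assume "r > 0"
    then obtain N where N: "\<forall>j\<ge>N. \<forall>k\<ge>N. ip_norm ell2_ip (X j - X k) < r"
      using C unfolding ip_Cauchy_def by blast
    have "dist (X j i) (X k i) < r" if "j \<ge> N" "k \<ge> N" for j k
      using coordinate_le_ell2_norm[OF diff, of j k i] N that
      by (force simp: dist_norm)
    then show "\<exists>N. \<forall>j\<ge>N. \<forall>k\<ge>N. dist (X j i) (X k i) < r" by blast
  qed
  then have "\<forall>i. \<exists>a. (\<lambda>k. X k i) \<longlonglongrightarrow> a"
    by (simp add: Cauchy_convergent_iff convergent_def)
  then obtain l where l: "(\<lambda>k. X k i) \<longlonglongrightarrow> l i" for i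
    using choice by metis
  have tail: "\<exists>N. \<forall>j\<ge>N. X j - l \<in> ell2 \<and> ip_norm ell2_ip (X j - l) \<le> r" if "r > 0" for r
  proof -
    obtain N where N: "\<forall>j\<ge>N. \<forall>k\<ge>N. ip_norm ell2_ip (X j - X k) < r"
      using C \<open>r > 0\<close> unfolding ip_Cauchy_def by blast
    have "(\<Sum>i<m. (cmod ((X j - l) i))\<^sup>2) \<le> r\<^sup>2" if j: "j \<ge> N" for j m
    proof (rule LIMSEQ_le_const2)
      show "(\<lambda>k. \<Sum>i<m. (cmod ((X j - X k) i))\<^sup>2) \<longlonglongrightarrow> (\<Sum>i<m. (cmod ((X j - l) i))\<^sup>2)"
        unfolding fun_diff_def by (intro tendsto_intros l)
      have "(\<Sum>i<m. (cmod ((X j - X k) i))\<^sup>2) \<le> r\<^sup>2" if "k \<ge> N" for k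
      proof -
        have "(ip_norm ell2_ip (X j - X k))\<^sup>2 \<le> r\<^sup>2"
          using N j that by (intro power_mono ell2_norm_nonneg diff) (simp add: less_imp_le)
        then show ?thesis
          using sum_le_ell2_norm_square[OF diff] order_trans by blast
      qed
      then show "\<exists>N. \<forall>k\<ge>N. (\<Sum>i<m. (cmod ((X j - X k) i))\<^sup>2) \<le> r\<^sup>2" by blast
    qed
    then show ?thesis
      using ell2_norm_leI[of "X _ - l" r] \<open>r > 0\<close> by (meson less_imp_le)
  qed
  obtain j where "X j - l \<in> ell2" using tail[of 1] by auto
  then have "X j - (X j - l) \<in> ell2"
    by (rule seqs.subspace_diff[OF subspace_ell2 X])
  then have lin: "l \<in> ell2" by simp
  have "ip_tendsto ell2_ip X l"
    unfolding ip_tendsto_def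
  proof (rule LIMSEQ_I)
    fix r :: real assume "r > 0"
    then obtain N where N: "\<forall>j\<ge>N. X j - l \<in> ell2 \<and> ip_norm ell2_ip (X j - l) \<le> r / 2"
      using tail[of "r / 2"] by auto
    have "norm (ip_norm ell2_ip (X j - l) - 0) < r" if "j \<ge> N" for j
      using N that \<open>r > 0\<close> ell2_norm_nonneg[of "X j - l"] by force
    then show "\<exists>N. \<forall>j\<ge>N. norm (ip_norm ell2_ip (X j - l) - 0) < r" by blast
  qed
  with lin show ?thesis by blast
qed

lemma complex_hilbert_space_ell2: "complex_hilbert_space seq_scale ell2 ell2_ip"
proof (rule complex_hilbert_space.intro[OF vector_space_seq_scale], unfold_locales)
  show "seqs.subspace ell2" by (rule subspace_ell2)
next
  fix x y z assume "x \<in> ell2" "y \<in> ell2" "z \<in> ell2"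
  then show "ell2_ip (x + y) z = ell2_ip x z + ell2_ip y z"
    unfolding ell2_ip_def
    by (simp add: suminf_add[OF ell2_ip_summable ell2_ip_summable] distrib_right)
next
  fix x y c assume "x \<in> ell2" "y \<in> ell2"
  then show "ell2_ip (seq_scale c x) y = c * ell2_ip x y"
    unfolding ell2_ip_def seq_scale_def
    by (simp add: suminf_mult[OF ell2_ip_summable, symmetric] mult.assoc)
next
  fix x y assume "x \<in> ell2" "y \<in> ell2"
  then have "(\<lambda>i. cnj (y i * cnj (x i))) sums cnj (ell2_ip y x)"
    unfolding ell2_ip_def sums_cnj by (intro summable_sums ell2_ip_summable)
  then show "ell2_ip x y = cnj (ell2_ip y x)"
    by (simp add: ell2_ip_def sums_iff mult.commute)
next
  fix x assume "x \<in> ell2"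
  then show "0 \<le> Re (ell2_ip x x)"
    by (auto simp: ell2_ip_self ell2_def intro: suminf_nonneg)
next
  fix x assume x: "x \<in> ell2" "ell2_ip x x = 0"
  then have "cmod (x i) \<le> 0" for i
    using coordinate_le_ell2_norm[OF x(1), of i] by (simp add: ip_norm_def)
  then show "x = 0" by (simp add: fun_eq_iff)
next
  fix X assume "\<And>k. X k \<in> ell2" "ip_Cauchy ell2_ip X"
  then show "\<exists>l\<in>ell2. ip_tendsto ell2_ip X l" by (rule ell2_complete)
qed

section \<open>A discontinuous functional\<close>

lemma unit_seq_in_ell2: "unit_seq k \<in> ell2"
  and ell2_norm_unit_seq: "ip_norm ell2_ip (unit_seq k) = 1"
proof -
  have "(\<lambda>i. (cmod (unit_seq k i))\<^sup>2) = (\<lambda>i. if i = k then 1 else 0)"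
    by (auto simp: unit_seq_def)
  then have s: "(\<lambda>i. (cmod (unit_seq k i))\<^sup>2) sums 1"
    using sums_single[of k "\<lambda>_. 1::real"] by simp
  then show mem: "unit_seq k \<in> ell2" by (simp add: ell2_def sums_iff)
  from s show "ip_norm ell2_ip (unit_seq k) = 1"
    by (simp add: ip_norm_def ell2_ip_self[OF mem] sums_iff)
qed

lemma inj_unit_seq: "inj unit_seq"
proof (rule injI)
  fix j k assume "unit_seq j = unit_seq k"
  then have "unit_seq j j = unit_seq k j" by simp
  then show "j = k" by (simp add: unit_seq_def split: if_splits)
qed

lemma independent_unit_seqs: "seqs.independent (range unit_seq)"
  unfolding seqs.independent_explicit_module
proof (intro allI impI)
  fix t u v
  assume t: "finite t" "t \<subseteq> range unit_seq" and s: "(\<Sum>v\<in>t. seq_scale (u v) v) = 0" and v: "v \<in> t"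
  obtain k where k: "v = unit_seq k" using t v by auto
  have apply_sum: "(\<Sum>x\<in>A. g x) k = (\<Sum>x\<in>A. g x k)"
    for A and g :: "(nat \<Rightarrow> complex) \<Rightarrow> nat \<Rightarrow> complex"
    by (induction A rule: infinite_finite_induct) auto
  have "0 = (\<Sum>x\<in>t. u x * x k)"
    using arg_cong[OF s, of "\<lambda>g. g k"] by (simp add: apply_sum seq_scale_def)
  also have "\<dots> = (\<Sum>x\<in>t. if x = v then u v else 0)"
  proof (intro sum.cong refl)
    fix x assume "x \<in> t"
    then obtain j where "x = unit_seq j" using t(2) by auto
    then show "u x * x k = (if x = v then u v else 0)"
      using inj_unit_seq by (cases "j = k") (auto simp: k inj_eq, auto simp: unit_seq_def)
  qed
  also have "\<dots> = u v" using t(1) v by simp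
  finally show "u v = 0" by simp
qed

lemma exists_functional_on_unit_seqs:
  "\<exists>f. Vector_Spaces.linear seq_scale (*) f \<and> (\<forall>k. f (unit_seq k) = c k)"
proof -
  interpret vector_space_pair seq_scale "(*) :: complex \<Rightarrow> complex \<Rightarrow> complex"
    by unfold_locales (auto simp: algebra_simps)
  from linear_independent_extend[OF independent_unit_seqs, of "\<lambda>x. c (inv unit_seq x)"]
  show ?thesis by (auto simp: inj_unit_seq)
qed

text \<open>A functional with \<open>f \<delta>\<^sub>k = k\<close> takes the value \<open>1\<close> at every term of this null sequence, so it
  is discontinuous.\<close>

lemma scaled_unit_seqs_tendsto_0: "ip_tendsto ell2_ip (\<lambda>k. seq_scale (1 / of_nat (Suc k)) (unit_seq (Suc k))) 0"
proof -
  interpret complex_hilbert_space seq_scale ell2 ell2_ip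
    by (rule complex_hilbert_space_ell2)
  have "ip_norm ell2_ip (seq_scale (1 / of_nat (Suc k)) (unit_seq (Suc k)) - 0) = 1 / real (Suc k)" for k
    by (simp only: diff_zero ip_norm_scale[OF unit_seq_in_ell2] ell2_norm_unit_seq norm_divide
        norm_one norm_of_nat mult_1_right)
  then show ?thesis
    unfolding ip_tendsto_def using LIMSEQ_inverse_real_of_nat by (simp add: inverse_eq_divide)
qed

section \<open>Infinitely many operators\<close>

lemma exists_primitive_root_of_unity:
  fixes n :: nat
  assumes "n \<noteq> 1"
  shows "\<exists>w::complex. w \<noteq> 1 \<and> w ^ n = 1 \<and> (\<forall>p\<in>{1..<n}. w ^ p \<noteq> 1)"
proof (cases "n = 0")
  case True
  then show ?thesis by (intro exI[of _ "-1"]) auto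
next
  case False
  with assms have n: "n \<ge> 2" by simp
  let ?r = "\<lambda>k. cis (2 * pi * real k / real n)"
  have bij: "bij_betw ?r {..<n} {z. z ^ n = 1}"
    using False by (intro bij_betw_roots_unity) simp
  have pow: "?r 1 ^ p = ?r p" for p
    by (simp add: DeMoivre algebra_simps)
  have "?r 1 ^ p \<noteq> 1" if "p \<in> {1..<n}" for p
  proof
    assume "?r 1 ^ p = 1"
    then have "?r p = ?r 0" unfolding pow by simp
    moreover have "inj_on ?r {..<n}" using bij by (rule bij_betw_imp_inj_on)
    ultimately have "p = 0"
      using that n by (intro inj_onD[of ?r "{..<n}" p 0]) auto
    with that show False by simp
  qed
  moreover have "?r 1 ^ n = 1"
    using bij_betwE[OF bij] n by (auto dest: bspec[of _ _ 1])
  moreover have "?r 1 \<noteq> 1"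
    using calculation(1)[of 1] n by simp
  ultimately show ?thesis by blast
qed

theorem theorem1p36:
  fixes n :: nat
  assumes "n \<noteq> 1"
  shows "\<exists>(scale :: complex \<Rightarrow> (nat \<Rightarrow> complex) \<Rightarrow> (nat \<Rightarrow> complex)) H ip.
           complex_hilbert_space scale H ip \<and>
           infinite {T. linear_operator scale H T \<and> everywhere_defined H T \<and>
                        \<not> closable H ip T \<and> \<not> bounded_operator ip T \<and>
                        operator_power H T n = identity_operator H \<and>
                        (\<forall>p\<in>{1..<n}. operator_power H T p \<noteq> identity_operator H)}"
proof -
  interpret complex_hilbert_space seq_scale ell2 ell2_ip
    by (rule complex_hilbert_space_ell2)
  obtain w :: complex where w: "w \<noteq> 1" "w ^ n = 1" "\<And>p. p \<in> {1..<n} \<Longrightarrow> w ^ p \<noteq> 1"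
    using exists_primitive_root_of_unity[OF assms] by blast
  obtain f where f: "Vector_Spaces.linear seq_scale (*) f" and fu: "\<And>k. f (unit_seq k) = of_nat k"
    using exists_functional_on_unit_seqs[of of_nat] by auto
  define e where "e t = unit_seq 1 + seq_scale t (unit_seq 0)" for t
  define T where "T t = axis_dilation seq_scale ell2 f (e t) w" for t
  have eH: "e t \<in> ell2" for t
    unfolding e_def by (intro axis_dilation_in_carrier unit_seq_in_ell2)
  have fe: "f (e t) = 1" for t
    by (simp add: e_def linear_functional_simps[OF f] fu)
  have e0: "e t \<noteq> 0" for t
    using fe[of t] linear_functional_simps(1)[OF f, of 0 0] by auto
  have lin: "linear_operator seq_scale ell2 (T t)" for t
    unfolding T_def by (rule linear_operator_axis_dilation[OF f eH])
  have nclo: "\<not> closable ell2 ell2_ip (T t)" for t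
    unfolding T_def
  proof (rule not_closable_axis_dilation[OF eH e0 w(1) _ _ scaled_unit_seqs_tendsto_0])
    fix k
    show "seq_scale (1 / of_nat (Suc k)) (unit_seq (Suc k)) \<in> ell2"
      by (intro seqs.subspace_scale[OF subspace_ell2] unit_seq_in_ell2)
    show "f (seq_scale (1 / of_nat (Suc k)) (unit_seq (Suc k))) = 1"
      by (simp add: linear_functional_simps[OF f] fu del: of_nat_Suc)
  qed
  have ed: "everywhere_defined ell2 (T t)" for t
    by (simp add: T_def everywhere_defined_def)
  have nbdd: "\<not> bounded_operator ell2_ip (T t)" for t
    using bounded_operator_imp_closable[of "T t"] nclo lin by (auto simp: linear_operator_def)
  have pow: "operator_power ell2 (T t) k = identity_operator ell2 \<longleftrightarrow> w ^ k = 1" for t k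
    unfolding T_def operator_power_axis_dilation[OF f eH fe]
    using axis_dilation_inject[of "e t" f "w ^ k" 1] eH fe e0 by (auto simp: axis_dilation_one)
  have "inj T"
  proof (rule injI)
    fix s t assume "T s = T t"
    \<comment> \<open>\<open>f \<delta>\<^sub>1 = 1\<close>, so the images of \<open>\<delta>\<^sub>1\<close> reveal \<open>e s\<close> and \<open>e t\<close>, whose coordinates at \<open>0\<close> are \<open>s\<close> and \<open>t\<close>.\<close>
    then have "T s (unit_seq 1) = T t (unit_seq 1)" by simp
    then have "seq_scale (w - 1) (e s) = seq_scale (w - 1) (e t)"
      by (simp add: T_def axis_dilation_apply unit_seq_in_ell2 fu)
    then have "e s 0 = e t 0"
      using w(1) by (simp add: scale_left_imp_eq)
    then show "s = t"
      by (simp add: e_def seq_scale_def unit_seq_def)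
  qed
  then have "infinite (range T)"
    using finite_imageD infinite_UNIV_char_0 by blast
  moreover have "range T \<subseteq> {T. linear_operator seq_scale ell2 T \<and> everywhere_defined ell2 T \<and>
      \<not> closable ell2 ell2_ip T \<and> \<not> bounded_operator ell2_ip T \<and>
      operator_power ell2 T n = identity_operator ell2 \<and>
      (\<forall>p\<in>{1..<n}. operator_power ell2 T p \<noteq> identity_operator ell2)}"
    using lin ed nclo nbdd w by (auto simp: pow)
  ultimately show ?thesis
    using complex_hilbert_space_ell2 infinite_super by blast
qed

end
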